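(* For every integer $d\ge 1$, there exists a least positive integer $n_d\ge 2$ such that for every integer $n\ge n_d$, the poset $\operatorname{Kelly}(n,d)$ satisfies $\operatorname{ldim}(\operatorname{Kelly}(n,d))\ge d$.
   Context: All posets are finite. A partial linear extension (ple) of a poset $P$ is a linear extension of a subposet of $P$. For a family $\mathcal{L}$ of ple's of $P$ and $u\in P$, let $\mu(u,\mathcal{L})=|\{L\in\mathcal{L}: u\in L\}|$ and $\mu(P,\mathcal{L})=\max_{u\in P}\mu(u,\mathcal{L})$. A family $\mathcal{L}$ of ple's of $P$ is a local realizer of $P$ if (1) whenever $x<y$ in $P$ there is $L\in\mathcal{L}$ with $x<y$ in $L$, and (2) whenever $x,y$ are incomparable in $P$ there is $L\in\mathcal{L}$ with $x>y$ in $L$. The local dimension $\operatorname{ldim}(P)$ is the least positive integer $d$ such that $P$ has a local realizer $\mathcal{L}$ with $\mu(P,\mathcal{L})=d$. Kelly construction: for $n\ge 2$, $K_n$ is the poset on $\{a_1,\dots,a_n,b_1,\dots,b_n,w_1,\dots,w_{n-1},z_1,\dots,z_{n-1}\}$ whose order is the transitive closure of the relations $a_i<w_i<b_{i+1}$ and $a_{i+1}<z_i<b_i$ for $1\le i\le n-1$, $w_i<w_{i+1}$ and $z_{i+1}<z_i$ for $1\le i\le n-2$. (Then $a_i<b_j$ iff $i\ne j$.) Posets $\operatorname{Kelly}(n,d)$, $n\ge2$, $d\ge1$, whose elements are finite sequences: $\operatorname{Kelly}(n,1)=K_n$, each element $x$ viewed as the length-one sequence $(x)$. Given $\operatorname{Kelly}(n,d)$,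 the poset $\operatorname{Kelly}(n,d+1)$ is obtained from $K_n$ as follows: for each $i=1,\dots,n$, take a copy of $\operatorname{Kelly}(n,d)$, relabel each of its elements $(x_1,\dots,x_k)$ as $(a_i,x_1,\dots,x_k)$, and identify the element $(a_i,b_n)$ of this copy with the element $a_i$ of $K_n$ (the identified element is named $(a_i,b_n)$). The order of $\operatorname{Kelly}(n,d+1)$ is the transitive closure of the union of the order of $K_n$ and the orders of the $n$ copies. (All these posets are planar.) *)

theory Defs
  imports Main
begin

text \<open>
  A poset is given by its ground set \<open>P\<close> and its reflexive order relation \<open>r\<close>, with
  \<open>partial_order_on P r\<close>; hence \<open>x < y\<close> means \<open>x \<noteq> y \<and> (x, y) \<in> r\<close>.
  A linear order on a set determines that set as its \<^const>\<open>Field\<close>, so a partial linear extension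
  is represented by its order relation alone.
\<close>

definition ple :: "'a set \<Rightarrow> 'a rel \<Rightarrow> 'a rel \<Rightarrow> bool" where
  "ple P r L \<longleftrightarrow> Field L \<subseteq> P \<and> linear_order_on (Field L) L \<and> r \<inter> (Field L \<times> Field L) \<subseteq> L"

definition local_realizer :: "'a set \<Rightarrow> 'a rel \<Rightarrow> 'a rel set \<Rightarrow> bool" where
  "local_realizer P r \<L> \<longleftrightarrow>
     (\<forall>L\<in>\<L>. ple P r L) \<and>
     (\<forall>x\<in>P. \<forall>y\<in>P. x \<noteq> y \<and> (x, y) \<in> r \<longrightarrow> (\<exists>L\<in>\<L>. (x, y) \<in> L)) \<and>
     (\<forall>x\<in>P. \<forall>y\<in>P. (x, y) \<notin> r \<and> (y, x) \<notin> r \<longrightarrow> (\<exists>L\<in>\<L>. (y, x) \<in> L))"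

definition occurrences :: "'a \<Rightarrow> 'a rel set \<Rightarrow> nat" where
  "occurrences u \<L> = card {L \<in> \<L>. u \<in> Field L}"

definition max_occurrences :: "'a set \<Rightarrow> 'a rel set \<Rightarrow> nat" where
  "max_occurrences P \<L> = Max ((\<lambda>u. occurrences u \<L>) ` P)"

definition ldim :: "'a set \<Rightarrow> 'a rel \<Rightarrow> nat" where
  "ldim P r = (LEAST d. d > 0 \<and> (\<exists>\<L>. local_realizer P r \<L> \<and> max_occurrences P \<L> = d))"

datatype kelly_point = Ka nat | Kb nat | Kw nat | Kz nat

definition K_set :: "nat \<Rightarrow> kelly_point set" where
  "K_set n = Ka ` {1..n} \<union> Kb ` {1..n} \<union> Kw ` {1..<n} \<union> Kz ` {1..<n}"

definition K_gen :: "nat \<Rightarrow> kelly_point rel" where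
  "K_gen n =
     (\<Union>i\<in>{1..<n}. {(Ka i, Kw i), (Kw i, Kb (i + 1)), (Ka (i + 1), Kz i), (Kz i, Kb i)}) \<union>
     (\<Union>i\<in>{i. 1 \<le> i \<and> i + 1 < n}. {(Kw i, Kw (i + 1)), (Kz (i + 1), Kz i)})"

definition K_ord :: "nat \<Rightarrow> kelly_point rel" where
  "K_ord n = (K_gen n)\<^sup>+ \<union> Id_on (K_set n)"

text \<open>The name of a point of \<open>K_set n\<close> inside \<open>Kelly(n, d)\<close> for \<open>d \<ge> 2\<close>: the point \<open>Ka i\<close> is
  identified with the point \<open>[Kb n]\<close> of the \<open>i\<close>-th copy of \<open>Kelly(n, d - 1)\<close>.\<close>

fun K_name :: "nat \<Rightarrow> kelly_point \<Rightarrow> kelly_point list" where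
  "K_name n (Ka i) = [Ka i, Kb n]"
| "K_name n x = [x]"

text \<open>The value at \<open>d = 0\<close> is a dummy.\<close>

fun kelly_set :: "nat \<Rightarrow> nat \<Rightarrow> kelly_point list set" where
  "kelly_set n 0 = {}"
| "kelly_set n (Suc 0) = (\<lambda>x. [x]) ` K_set n"
| "kelly_set n (Suc (Suc d)) =
     K_name n ` K_set n \<union> (\<Union>i\<in>{1..n}. (\<lambda>xs. Ka i # xs) ` kelly_set n (Suc d))"

fun kelly_ord :: "nat \<Rightarrow> nat \<Rightarrow> kelly_point list rel" where
  "kelly_ord n 0 = {}"
| "kelly_ord n (Suc 0) = map_prod (\<lambda>x. [x]) (\<lambda>x. [x]) ` K_ord n"
| "kelly_ord n (Suc (Suc d)) =
     (map_prod (K_name n) (K_name n) ` K_ord n \<union>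
      (\<Union>i\<in>{1..n}. map_prod (\<lambda>xs. Ka i # xs) (\<lambda>xs. Ka i # xs) ` kelly_ord n (Suc d)))\<^sup>+"

end

theory Submission
  imports Defs
begin

text \<open>
  Let every point occur in at most \<open>c\<close> members of a local realizer. In a copy of \<open>K_n\<close>, a member
  \<open>L\<close> can place \<open>b_i\<close> below some point under \<open>a_i\<close> for at most one \<open>i\<close>: if \<open>b_i < x\<close> and
  \<open>b_k < y\<close> in \<open>L\<close>, with \<open>x \<le> a_i\<close>, \<open>y \<le> a_k\<close> and \<open>i \<noteq> k\<close>, then \<open>x < b_k < y < b_i < x\<close>. Hence,
  for large \<open>n\<close>, one can choose \<open>i_1, \<dots>, i_d < n\<close> successively such that no \<open>L\<close> containing one of
  the earlier points \<open>b_{i_1}, \<dots>, b_{i_{j-1}}\<close> places \<open>b_{i_j}\<close> below a point under \<open>a_{i_j}\<close>. The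
  point \<open>(a_{i_1}, \<dots>, a_{i_d})\<close> has to be above each of the \<open>d\<close> points \<open>b_{i_j}\<close> in some \<open>L\<close>, and
  by the choice of the indices these \<open>d\<close> members are distinct.
\<close>

section \<open>The order of the Kelly posets\<close>

lemma K_ord_trans: "trans (K_ord n)"
  unfolding K_ord_def trans_def by (auto intro: trancl_trans)

lemma K_ord_a_less_w:
  assumes "1 \<le> i" "i \<le> k" "k < n"
  shows "(Ka i, Kw k) \<in> (K_gen n)\<^sup>+"
  using assms(2,3)
proof (induction k rule: dec_induct)
  case base
  then show ?case using assms(1) by (intro r_into_trancl) (auto simp: K_gen_def)
next
  case (step k)
  have "(Kw k, Kw (Suc k)) \<in> K_gen n"
    using step.hyps step.prems assms(1) by (auto simp: K_gen_def)
  then show ?case using step by (auto intro: trancl_into_trancl)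
qed

lemma K_ord_z_less_b:
  assumes "1 \<le> k" "k \<le> i" "i < n"
  shows "(Kz i, Kb k) \<in> (K_gen n)\<^sup>+"
  using assms(2,3)
proof (induction i rule: dec_induct)
  case base
  then show ?case using assms(1) by (intro r_into_trancl) (auto simp: K_gen_def)
next
  case (step i)
  have "(Kz (Suc i), Kz i) \<in> K_gen n"
    using step.hyps step.prems assms(1) by (auto simp: K_gen_def)
  then show ?case using step by (auto intro: trancl_into_trancl2)
qed

text \<open>For \<open>i < k\<close> the chain climbs through w_i, ..., w_{k-1}; for
  \<open>k < i\<close> it climbs through z_{i-1}, ..., z_k.\<close>

lemma K_ord_a_less_b:
  assumes "i \<in> {1..n}" "k \<in> {1..n}" "i \<noteq> k"
  shows "(Ka i, Kb k) \<in> K_ord n"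
proof (cases "i < k")
  case True
  then obtain m where m: "k = Suc m" by (cases k) auto
  have "(Kw m, Kb k) \<in> K_gen n" using True m assms by (auto simp: K_gen_def)
  then have "(Ka i, Kb k) \<in> (K_gen n)\<^sup>+"
    using K_ord_a_less_w[of i m n] True m assms by (auto intro: trancl_into_trancl)
  then show ?thesis by (simp add: K_ord_def)
next
  case False
  then obtain m where m: "i = Suc m" using assms by (cases i) auto
  have "(Ka i, Kz m) \<in> K_gen n" using False m assms by (auto simp: K_gen_def)
  then have "(Ka i, Kb k) \<in> (K_gen n)\<^sup>+"
    using K_ord_z_less_b[of k m n] False m assms by (auto intro: trancl_into_trancl2)
  then show ?thesis by (simp add: K_ord_def)
qed

text \<open>A closed form of the up-set of \<open>Ka i\<close>. To refute a relation in a transitive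
  closure one needs such an invariant: it holds at \<open>Ka i\<close> and fails at
  \<open>Kb i\<close>.\<close>

fun above_a :: "nat \<Rightarrow> kelly_point \<Rightarrow> bool" where
  "above_a i (Ka k) \<longleftrightarrow> k = i"
| "above_a i (Kb k) \<longleftrightarrow> k \<noteq> i"
| "above_a i (Kw k) \<longleftrightarrow> i \<le> k"
| "above_a i (Kz k) \<longleftrightarrow> k < i"

lemma above_a_upward:
  assumes "(v, w) \<in> K_ord n" "above_a i v"
  shows "above_a i w"
proof -
  have gen: "above_a i y" if "(x, y) \<in> K_gen n" "above_a i x" for x y
    using that by (auto simp: K_gen_def)
  have "above_a i w" if "(v, w) \<in> (K_gen n)\<^sup>+"
    using that by (induction rule: trancl_induct) (use assms(2) gen in auto)
  then show ?thesis using assms by (auto simp: K_ord_def)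
qed

text \<open>A strictly increasing rank certifies antisymmetry: the b's sit at 0, the a's at -n, and
  both chains strictly between.\<close>

fun K_rank :: "nat \<Rightarrow> kelly_point \<Rightarrow> int" where
  "K_rank n (Ka i) = - int n"
| "K_rank n (Kb i) = 0"
| "K_rank n (Kw i) = int i - int n"
| "K_rank n (Kz i) = - int i"

lemma K_rank_less:
  assumes "(v, w) \<in> K_ord n"
  shows "v = w \<or> K_rank n v < K_rank n w"
proof -
  have gen: "K_rank n x < K_rank n y" if "(x, y) \<in> K_gen n" for x y
    using that by (auto simp: K_gen_def)
  have "K_rank n v < K_rank n w" if "(v, w) \<in> (K_gen n)\<^sup>+"
    using that by (induction rule: trancl_induct) (use gen in \<open>auto intro: less_trans\<close>)
  then show ?thesis using assms by (auto simp: K_ord_def)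
qed

text \<open>Shifting the \<open>i\<close>-th copy by \<open>- n\<close> makes the two names of an identified point agree:
  \<open>[Ka i, Kb n]\<close> gets the rank of \<open>Ka i\<close>.\<close>

fun kelly_rank :: "nat \<Rightarrow> kelly_point list \<Rightarrow> int" where
  "kelly_rank n [] = 0"
| "kelly_rank n [x] = K_rank n x"
| "kelly_rank n (x # y # xs) = kelly_rank n (y # xs) - int n"

lemma kelly_rank_name [simp]: "kelly_rank n (K_name n v) = K_rank n v"
  by (cases v) auto

lemma kelly_rank_Cons: "xs \<noteq> [] \<Longrightarrow> kelly_rank n (x # xs) = kelly_rank n xs - int n"
  by (cases xs) auto

section \<open>Gluing and the order axioms of the recursive posets\<close>

lemma K_name_inj: "K_name n v = K_name n w \<Longrightarrow> v = w"
  by (cases v; cases w) auto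

text \<open>One-letter names never start with an a, so \<open>K_n\<close> and a copy meet only in
  the identified point.\<close>

lemma K_name_eq_Cons: "K_name n v = Ka i # xs \<Longrightarrow> v = Ka i \<and> xs = [Kb n]"
  by (cases v) auto

lemma K_ord_subset: "K_ord n \<subseteq> K_set n \<times> K_set n"
proof -
  have "K_gen n \<subseteq> K_set n \<times> K_set n"
    by (auto simp: K_gen_def K_set_def)
  then have "(K_gen n)\<^sup>+ \<subseteq> K_set n \<times> K_set n" by (rule trancl_subset_Sigma)
  then show ?thesis by (auto simp: K_ord_def)
qed

lemma kelly_set_nonempty_list: "xs \<in> kelly_set n d \<Longrightarrow> xs \<noteq> []"
proof (induction n d rule: kelly_set.induct)
  case (3 n d)
  have "[] \<noteq> K_name n v" for v by (cases v) auto
  with 3 show ?case by auto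
qed auto

lemma kelly_set_copyI:
  "i \<in> {1..n} \<Longrightarrow> x \<in> kelly_set n (Suc d) \<Longrightarrow> Ka i # x \<in> kelly_set n (Suc (Suc d))"
  by auto

lemma kelly_ord_subset: "kelly_ord n d \<subseteq> kelly_set n d \<times> kelly_set n d"
proof (induction n d rule: kelly_set.induct)
  case (2 n)
  then show ?case using K_ord_subset[of n] by auto
next
  case (3 n d)
  have "map_prod (\<lambda>xs. Ka i # xs) (\<lambda>xs. Ka i # xs) ` kelly_ord n (Suc d)
      \<subseteq> kelly_set n (Suc (Suc d)) \<times> kelly_set n (Suc (Suc d))" if "i \<in> {1..n}" for i
    using 3[OF that] kelly_set_copyI[OF that] by auto blast+
  moreover have "map_prod (K_name n) (K_name n) ` K_ord n
      \<subseteq> kelly_set n (Suc (Suc d)) \<times> kelly_set n (Suc (Suc d))"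
    using K_ord_subset[of n] by auto
  ultimately show ?case
    unfolding kelly_ord.simps(3) by (intro trancl_subset_Sigma Un_least UN_least)
qed auto

lemma finite_kelly_set: "finite (kelly_set n d)"
  by (induction n d rule: kelly_set.induct) (auto simp: K_set_def)

lemma kelly_ord_trans: "trans (kelly_ord n d)"
proof (induction n d rule: kelly_set.induct)
  case (2 n)
  then show ?case using K_ord_trans[of n] by (auto simp: trans_def)
qed auto

lemma kelly_rank_less:
  "(x, y) \<in> kelly_ord n d \<Longrightarrow> x = y \<or> kelly_rank n x < kelly_rank n y"
proof (induction n d arbitrary: x y rule: kelly_set.induct)
  case (2 n)
  then show ?case using K_rank_less by fastforce
next
  case (3 n d)
  define R where "R = map_prod (K_name n) (K_name n) ` K_ord n \<union>
    (\<Union>i\<in>{1..n}. map_prod (\<lambda>xs. Ka i # xs) (\<lambda>xs. Ka i # xs) ` kelly_ord n (Suc d))"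
  have R: "v = w \<or> kelly_rank n v < kelly_rank n w" if vw: "(v, w) \<in> R" for v w
  proof (cases "(v, w) \<in> map_prod (K_name n) (K_name n) ` K_ord n")
    case True
    then obtain v' w' where "(v', w') \<in> K_ord n" "v = K_name n v'" "w = K_name n w'" by auto
    then show ?thesis using K_rank_less[of v' w' n] by auto
  next
    case False
    then obtain i v' w' where i: "i \<in> {1..n}" "v = Ka i # v'" "w = Ka i # w'"
      "(v', w') \<in> kelly_ord n (Suc d)"
      using vw unfolding R_def by auto
    then have "v' \<noteq> []" "w' \<noteq> []"
      using kelly_ord_subset kelly_set_nonempty_list by blast+
    then show ?thesis using "3.IH"[OF i(1,4)] i by (auto simp: kelly_rank_Cons)
  qed
  have "(x, y) \<in> R\<^sup>+" using "3.prems" by (simp add: R_def)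
  then show ?case
    by (induction rule: trancl_induct) (use R in force)+
qed auto

lemma kelly_ord_antisym: "antisym (kelly_ord n d)"
  by (rule antisymI) (metis kelly_rank_less less_asym)

lemma kelly_ord_copyI:
  "i \<in> {1..n} \<Longrightarrow> (x, y) \<in> kelly_ord n (Suc d) \<Longrightarrow> (Ka i # x, Ka i # y) \<in> kelly_ord n (Suc (Suc d))"
  unfolding kelly_ord.simps by (intro r_into_trancl) auto

lemma kelly_ord_refl: "x \<in> kelly_set n d \<Longrightarrow> (x, x) \<in> kelly_ord n d"
proof (induction n d arbitrary: x rule: kelly_set.induct)
  case (2 n)
  then show ?case by (force simp: K_ord_def)
next
  case (3 n d)
  then consider v where "v \<in> K_set n" "x = K_name n v"
    | i y where "i \<in> {1..n}" "y \<in> kelly_set n (Suc d)" "x = Ka i # y"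
    by auto
  then show ?case
  proof cases
    case 1
    then have "(v, v) \<in> K_ord n" by (auto simp: K_ord_def)
    then show ?thesis unfolding kelly_ord.simps 1
      by (intro r_into_trancl UnI1) force
  next
    case 2
    then show ?thesis using "3.IH" kelly_ord_copyI by blast
  qed
qed auto

text \<open>The two alternatives form an invariant along a generating chain. The chain can leave
  copy \<open>i\<close> only through \<open>[Ka i, Kb n]\<close>, so \<open>x\<close> must be below
  \<open>[Kb n]\<close>; from there it climbs in \<open>K_n\<close>.\<close>

lemma kelly_ord_from_copy:
  assumes "(Ka i # x, y) \<in> kelly_ord n (Suc (Suc d))" "x \<in> kelly_set n (Suc d)"
  shows "(\<exists>y'. y = Ka i # y' \<and> (x, y') \<in> kelly_ord n (Suc d)) \<or>
    (\<exists>v. y = K_name n v \<and> above_a i v \<and> (x, [Kb n]) \<in> kelly_ord n (Suc d))"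
    (is "?Q y")
proof -
  have step: "?Q z" if Q: "?Q y" and yz: "(y, z) \<in> map_prod (K_name n) (K_name n) ` K_ord n \<union>
    (\<Union>i\<in>{1..n}. map_prod (\<lambda>xs. Ka i # xs) (\<lambda>xs. Ka i # xs) ` kelly_ord n (Suc d))" for y z
    using yz
  proof
    assume "(y, z) \<in> map_prod (K_name n) (K_name n) ` K_ord n"
    then obtain v w where vw: "(v, w) \<in> K_ord n" "y = K_name n v" "z = K_name n w" by auto
    then have "above_a i v \<and> (x, [Kb n]) \<in> kelly_ord n (Suc d)"
      using Q K_name_eq_Cons[of n v i] K_name_inj[of n v] by auto
    then show ?thesis using vw above_a_upward by blast
  next
    assume "(y, z) \<in> (\<Union>i\<in>{1..n}.
      map_prod (\<lambda>xs. Ka i # xs) (\<lambda>xs. Ka i # xs) ` kelly_ord n (Suc d))"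
    then obtain k y' z' where k: "y = Ka k # y'" "z = Ka k # z'"
      "(y', z') \<in> kelly_ord n (Suc d)" by auto
    \<comment> \<open>Copy \<open>k\<close> meets \<open>K_n\<close> only in \<open>Ka k\<close>,
      and \<open>above_a i (Ka k)\<close> forces \<open>k = i\<close>: the chain enters no other
      copy.\<close>
    have "k = i \<and> (x, y') \<in> kelly_ord n (Suc d)"
      using Q
    proof
      assume "\<exists>v. y = K_name n v \<and> above_a i v \<and> (x, [Kb n]) \<in> kelly_ord n (Suc d)"
      then obtain v where v: "K_name n v = Ka k # y'" "above_a i v"
        "(x, [Kb n]) \<in> kelly_ord n (Suc d)"
        using k(1) by auto
      with K_name_eq_Cons[OF v(1)] show ?thesis by simp
    qed (use k(1) in auto)
    then show ?thesis using k kelly_ord_trans[of n "Suc d"] by (auto dest: transD)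
  qed
  have start: "?Q (Ka i # x)" using kelly_ord_refl[OF assms(2)] by blast
  show ?thesis
    using assms(1) unfolding kelly_ord.simps(3)
    by (induction rule: trancl_induct) (rule step[OF start] step; assumption)+
qed

text \<open>A chain that leaves the copy and ends inside it ends at the identified point, where the
  relation already holds in the copy. Thus incomparability within a copy survives the
  gluing.\<close>

lemma kelly_ord_copyD:
  assumes "(Ka i # x, Ka i # y) \<in> kelly_ord n (Suc (Suc d))" "x \<in> kelly_set n (Suc d)"
  shows "(x, y) \<in> kelly_ord n (Suc d)"
  using kelly_ord_from_copy[OF assms] K_name_eq_Cons[of n _ i y] by auto

lemma kelly_ord_to_b:
  assumes "i \<in> {1..n}" "k \<in> {1..n}" "i \<noteq> k" "(x, [Kb n]) \<in> kelly_ord n (Suc d)"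
  shows "(Ka i # x, [Kb k]) \<in> kelly_ord n (Suc (Suc d))"
proof -
  have "(Ka i # x, [Ka i, Kb n]) \<in> kelly_ord n (Suc (Suc d))"
    using kelly_ord_copyI assms by blast
  moreover have "(K_name n (Ka i), K_name n (Kb k)) \<in> kelly_ord n (Suc (Suc d))"
    unfolding kelly_ord.simps
    by (intro r_into_trancl UnI1) (use K_ord_a_less_b[OF assms(1-3)] in force)
  ultimately show ?thesis using kelly_ord_trans[of n "Suc (Suc d)"] by (auto dest: transD)
qed

lemma b_in_kelly_set: "i \<in> {1..n} \<Longrightarrow> [Kb i] \<in> kelly_set n (Suc d)"
  by (cases d) (force simp: K_set_def image_iff intro: exI[of _ "Kb i"])+

declare kelly_set.simps(3) [simp del] kelly_ord.simps(3) [simp del]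

section \<open>Indexed families of partial linear extensions\<close>

text \<open>A point \<open>x\<close> occurs in \<open>L t\<close> iff \<open>(x, x) \<in> L t\<close>. The indices are needed since different members
  of a local realizer may have the same restriction to a copy.\<close>

locale ple_family =
  fixes P :: "'a set" and r :: "'a rel" and I :: "'t set" and L :: "'t \<Rightarrow> 'a rel" and c :: nat
  assumes trans: "t \<in> I \<Longrightarrow> trans (L t)"
    and antisym: "t \<in> I \<Longrightarrow> antisym (L t)"
    and refl: "t \<in> I \<Longrightarrow> (x, y) \<in> L t \<Longrightarrow> (x, x) \<in> L t \<and> (y, y) \<in> L t"
    and extends: "t \<in> I \<Longrightarrow> (x, y) \<in> r \<Longrightarrow> (x, x) \<in> L t \<Longrightarrow> (y, y) \<in> L t \<Longrightarrow> (x, y) \<in> L t"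
    and reverses: "x \<in> P \<Longrightarrow> y \<in> P \<Longrightarrow> (x, y) \<notin> r \<Longrightarrow> (y, x) \<notin> r \<Longrightarrow> \<exists>t\<in>I. (y, x) \<in> L t"
    and finite_occ: "x \<in> P \<Longrightarrow> finite {t \<in> I. (x, x) \<in> L t}"
    and card_occ: "x \<in> P \<Longrightarrow> card {t \<in> I. (x, x) \<in> L t} \<le> c"

text \<open>Restriction to a copy keeps the index set and the bound \<open>c\<close>, since
  \<open>x\<close> occurs in the restriction of \<open>L t\<close> exactly when
  \<open>Ka i # x\<close> occurs in \<open>L t\<close>. This carries the induction on depth.\<close>

lemma ple_family_copy:
  assumes "ple_family (kelly_set n (Suc (Suc d))) (kelly_ord n (Suc (Suc d))) I L c" "i \<in> {1..n}"
  shows "ple_family (kelly_set n (Suc d)) (kelly_ord n (Suc d)) I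
    (\<lambda>t. inv_image (L t) ((#) (Ka i))) c"
proof -
  interpret ple_family "kelly_set n (Suc (Suc d))" "kelly_ord n (Suc (Suc d))" I L c
    by (fact assms)
  have P: "Ka i # x \<in> kelly_set n (Suc (Suc d))" if "x \<in> kelly_set n (Suc d)" for x
    using that assms(2) kelly_set_copyI by blast
  show ?thesis
  proof
    fix t x y assume "t \<in> I" "(x, y) \<in> inv_image (L t) ((#) (Ka i))"
    then show "(x, x) \<in> inv_image (L t) ((#) (Ka i)) \<and> (y, y) \<in> inv_image (L t) ((#) (Ka i))"
      using refl by auto
  next
    fix t assume "t \<in> I"
    then show "trans (inv_image (L t) ((#) (Ka i)))" using trans by (auto intro: trans_inv_image)
    show "antisym (inv_image (L t) ((#) (Ka i)))"
      using antisym[OF \<open>t \<in> I\<close>] by (auto simp: antisym_def)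
  next
    fix t x y
    assume "t \<in> I" "(x, y) \<in> kelly_ord n (Suc d)"
      "(x, x) \<in> inv_image (L t) ((#) (Ka i))" "(y, y) \<in> inv_image (L t) ((#) (Ka i))"
    then show "(x, y) \<in> inv_image (L t) ((#) (Ka i))"
      using extends kelly_ord_copyI[OF assms(2)] by auto
  next
    fix x y
    assume "x \<in> kelly_set n (Suc d)" "y \<in> kelly_set n (Suc d)"
      "(x, y) \<notin> kelly_ord n (Suc d)" "(y, x) \<notin> kelly_ord n (Suc d)"
    then show "\<exists>t\<in>I. (y, x) \<in> inv_image (L t) ((#) (Ka i))"
      using reverses[OF P P, of x y] kelly_ord_copyD[of i x y n d] kelly_ord_copyD[of i y x n d] by auto
  next
    fix x assume "x \<in> kelly_set n (Suc d)"
    then show "finite {t \<in> I. (x, x) \<in> inv_image (L t) ((#) (Ka i))}"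
      "card {t \<in> I. (x, x) \<in> inv_image (L t) ((#) (Ka i))} \<le> c"
      using finite_occ[OF P] card_occ[OF P] by simp_all
  qed
qed

text \<open>Pigeonhole: otherwise every index is assigned a member of \<open>F\<close>, and no
  member serves two indices. Lying below every other \<open>b k\<close> stands in for lying under
  a_i.\<close>

lemma (in ple_family) exists_unserved_index:
  fixes b :: "'k \<Rightarrow> 'a"
  assumes "finite F" "F \<subseteq> I" "card F < card J" "inj_on b J"
  shows "\<exists>i\<in>J. \<forall>t\<in>F. \<forall>x. (b i, x) \<in> L t \<longrightarrow> \<not> (\<forall>k\<in>J - {i}. (x, b k) \<in> r)"
proof (rule ccontr)
  assume "\<not> ?thesis"
  then have "\<forall>i\<in>J. \<exists>t x. t \<in> F \<and> (b i, x) \<in> L t \<and> (\<forall>k\<in>J - {i}. (x, b k) \<in> r)"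
    by blast
  then obtain s x where "\<forall>i\<in>J. s i \<in> F \<and> (b i, x i) \<in> L (s i) \<and> (\<forall>k\<in>J - {i}. (x i, b k) \<in> r)"
    by metis
  then have s: "\<And>i. i \<in> J \<Longrightarrow> s i \<in> F" "\<And>i. i \<in> J \<Longrightarrow> (b i, x i) \<in> L (s i)"
    "\<And>i k. i \<in> J \<Longrightarrow> k \<in> J \<Longrightarrow> k \<noteq> i \<Longrightarrow> (x i, b k) \<in> r"
    by auto
  have "inj_on s J"
  proof (rule inj_onI, rule ccontr)
    fix i k assume ik: "i \<in> J" "k \<in> J" "s i = s k" "i \<noteq> k"
    define M where "M = L (s i)"
    have t: "s i \<in> I" using s(1) ik assms by auto
    have M: "(b i, x i) \<in> M" "(b k, x k) \<in> M" using s(2) ik unfolding M_def by metis+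
    \<comment> \<open>All four points occur in \<open>M\<close>, so \<open>M\<close> must respect
      their relations in \<open>r\<close>.\<close>
    have "(x i, b k) \<in> M" "(x k, b i) \<in> M"
      using extends[OF t] refl[OF t] s(3) ik M unfolding M_def by metis+
    then have "(b i, b k) \<in> M" "(b k, b i) \<in> M"
      using M trans[OF t] unfolding M_def by (meson transD)+
    then have "b i = b k"
      using antisym[OF t] unfolding M_def by (meson antisymD)
    then show False using assms(4) ik by (auto dest: inj_onD)
  qed
  then have "card J \<le> card F"
    using s(1) assms(1) by (intro card_inj_on_le[of s]) auto
  with assms show False by simp
qed


text \<open>\<open>F\<close> collects the members ruled out by earlier choices. It grows by at most
  \<open>c\<close> at each of the \<open>d\<close> descents into a copy, whence the bound on
  \<open>n\<close>. The clause that \<open>u\<close> is below \<open>[Kb n]\<close> keeps the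
  prefixed point under a_i one level up.\<close>

lemma kelly_many_occurrences:
  assumes "ple_family (kelly_set n (Suc d)) (kelly_ord n (Suc d)) I L c"
    and "finite F" "F \<subseteq> I" "card F + c * d + 1 < n"
  shows "\<exists>u\<in>kelly_set n (Suc d). (u, [Kb n]) \<in> kelly_ord n (Suc d) \<and>
    (\<exists>T\<subseteq>I - F. card T = Suc d \<and> (\<forall>t\<in>T. (u, u) \<in> L t))"
  using assms
proof (induction d arbitrary: L F)
  case 0
  interpret ple_family "kelly_set n (Suc 0)" "kelly_ord n (Suc 0)" I L c
    by (fact "0.prems")
  \<comment> \<open>Index \<open>n\<close> is left out so that \<open>[Ka i]\<close> lies below
    \<open>[Kb n]\<close>.\<close>
  have "card F < card {1..<n}" using "0.prems" by simp
  then obtain i where i: "i \<in> {1..<n}"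
    "\<And>t x. t \<in> F \<Longrightarrow> ([Kb i], x) \<in> L t \<Longrightarrow> \<not> (\<forall>k\<in>{1..<n} - {i}. (x, [Kb k]) \<in> kelly_ord n (Suc 0))"
    using exists_unserved_index[of F "{1..<n}" "\<lambda>i. [Kb i]", OF "0.prems"(2,3)]
    by (force simp: inj_on_def simp del: kelly_ord.simps)
  have below: "([Ka i], [Kb k]) \<in> kelly_ord n (Suc 0)" if "k \<in> {1..n}" "k \<noteq> i" for k
    using K_ord_a_less_b[of i n k] that i by force
  have "[Ka i] \<in> kelly_set n (Suc 0)" "[Kb i] \<in> kelly_set n (Suc 0)"
    using i by (auto simp: K_set_def)
  moreover have "([Ka i], [Kb i]) \<notin> kelly_ord n (Suc 0)"
    using above_a_upward[of "Ka i" "Kb i" n i] by auto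
  moreover have "([Kb i], [Ka i]) \<notin> kelly_ord n (Suc 0)"
    using kelly_rank_less[of "[Kb i]" "[Ka i]" n "Suc 0"] i by (auto simp del: kelly_ord.simps)
  ultimately obtain t where t: "t \<in> I" "([Kb i], [Ka i]) \<in> L t"
    using reverses by blast
  have "t \<notin> F" using i(2)[OF _ t(2)] below by (auto simp del: kelly_ord.simps)
  show ?case
  proof (intro bexI conjI exI)
    show "[Ka i] \<in> kelly_set n (Suc 0)" by fact
    show "([Ka i], [Kb n]) \<in> kelly_ord n (Suc 0)" using below i by auto
    show "{t} \<subseteq> I - F" using t \<open>t \<notin> F\<close> by auto
    show "\<forall>t'\<in>{t}. ([Ka i], [Ka i]) \<in> L t'" using refl[OF t] by auto
  qed simp
next
  case (Suc d)
  interpret ple_family "kelly_set n (Suc (Suc d))" "kelly_ord n (Suc (Suc d))" I L c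
    by (fact "Suc.prems")
  have "card F < card {1..<n}" using "Suc.prems"(4) by simp
  then obtain i where i: "i \<in> {1..<n}"
    "\<And>t x. t \<in> F \<Longrightarrow> ([Kb i], x) \<in> L t \<Longrightarrow>
      \<not> (\<forall>k\<in>{1..<n} - {i}. (x, [Kb k]) \<in> kelly_ord n (Suc (Suc d)))"
    using exists_unserved_index[of F "{1..<n}" "\<lambda>i. [Kb i]", OF "Suc.prems"(2,3)]
    by (force simp: inj_on_def simp del: kelly_ord.simps)
  have i': "i \<in> {1..n}" using i by auto
  have bi: "[Kb i] \<in> kelly_set n (Suc (Suc d))" using b_in_kelly_set[OF i'] .
  \<comment> \<open>Ruling out these members inside the copy makes those found there differ from the
    one that will place \<open>[Kb i]\<close> below the new point.\<close>
  define G where "G = {t \<in> I. ([Kb i], [Kb i]) \<in> L t}"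
  have card_FG: "card (F \<union> G) \<le> card F + c"
    using card_Un_le[of F G] card_occ[OF bi] by (simp add: G_def)
  have "finite (F \<union> G)" "F \<union> G \<subseteq> I"
    using Suc.prems(2,3) finite_occ[OF bi] by (auto simp: G_def)
  moreover have "card (F \<union> G) + c * d + 1 < n"
    using Suc.prems(4) card_FG by simp
  ultimately obtain u T where u: "u \<in> kelly_set n (Suc d)" "(u, [Kb n]) \<in> kelly_ord n (Suc d)"
    and "T \<subseteq> I - (F \<union> G)" "card T = Suc d" "\<forall>t\<in>T. (u, u) \<in> inv_image (L t) ((#) (Ka i))"
    using Suc.IH[OF ple_family_copy[OF Suc.prems(1) i'], of "F \<union> G"] by blast
  then have T: "T \<subseteq> I - (F \<union> G)" "card T = Suc d" "\<And>t. t \<in> T \<Longrightarrow> (Ka i # u, Ka i # u) \<in> L t"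
    by auto
  have below: "(Ka i # u, [Kb k]) \<in> kelly_ord n (Suc (Suc d))" if "k \<in> {1..n}" "k \<noteq> i" for k
    using kelly_ord_to_b[OF i'] that u by blast
  have "u \<noteq> []" using kelly_set_nonempty_list[OF u(1)] .
  \<comment> \<open>Prefixing turns rank at most 0 into rank at most -n, below the rank 0 of
    \<open>[Kb i]\<close>.\<close>
  have "kelly_rank n u \<le> 0" using kelly_rank_less[OF u(2)] by auto
  then have "([Kb i], Ka i # u) \<notin> kelly_ord n (Suc (Suc d))"
    using kelly_rank_less[of "[Kb i]" "Ka i # u" n "Suc (Suc d)"] \<open>u \<noteq> []\<close> i
    by (auto simp: kelly_rank_Cons)
  moreover have "(Ka i # u, [Kb i]) \<notin> kelly_ord n (Suc (Suc d))"
  proof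
    assume "(Ka i # u, [Kb i]) \<in> kelly_ord n (Suc (Suc d))"
    then obtain v where "[Kb i] = K_name n v" "above_a i v"
      using kelly_ord_from_copy[OF _ u(1)] by blast
    then show False by (cases v) auto
  qed
  moreover have ui: "Ka i # u \<in> kelly_set n (Suc (Suc d))"
    using kelly_set_copyI[OF i' u(1)] .
  ultimately obtain t where t: "t \<in> I" "([Kb i], Ka i # u) \<in> L t"
    using reverses[OF ui bi] by blast
  \<comment> \<open>\<open>t\<close> places \<open>[Kb i]\<close> below a point that lies below all
    other \<open>[Kb k]\<close>; the choice of \<open>i\<close> forbids this within
    \<open>F\<close>.\<close>
  have "t \<notin> F" using i(2)[OF _ t(2)] below by (auto simp del: kelly_ord.simps)
  moreover have "t \<in> G" using refl[OF t] t by (auto simp: G_def)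
  ultimately have tT: "insert t T \<subseteq> I - F" "t \<notin> T" using T t by auto
  have "finite T" using T(2) by (intro card_ge_0_finite) simp
  show ?case
  proof (intro bexI[OF _ ui] conjI exI)
    show "(Ka i # u, [Kb n]) \<in> kelly_ord n (Suc (Suc d))" by (rule below) (use i in auto)
    show "\<forall>t'\<in>insert t T. (Ka i # u, Ka i # u) \<in> L t'" using refl[OF t] T by auto
    show "card (insert t T) = Suc (Suc d)" using T(2) tT(2) \<open>finite T\<close> by simp
  qed (fact tT(1))
qed

section \<open>Local dimension\<close>

text \<open>Two-element chains serve single pairs; the case \<open>x = y\<close> yields the
  one-point extension.\<close>

lemma ple_pair:
  assumes "x \<in> P" "y \<in> P" "(y, x) \<notin> r \<or> x = y"
  shows "ple P r {(x, x), (y, y), (x, y)}"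
proof -
  let ?L = "{(x, x), (y, y), (x, y)}"
  have F: "Field ?L = {x, y}" by auto
  have "?L \<subseteq> {x, y} \<times> {x, y}" by simp
  moreover have "refl_on {x, y} ?L" by (simp add: refl_on_def)
  moreover have "trans ?L" by (rule transI) blast
  moreover have "antisym ?L" by (rule antisymI) blast
  moreover have "total_on {x, y} ?L" by (simp add: total_on_def)
  moreover have "r \<inter> ({x, y} \<times> {x, y}) \<subseteq> ?L" using assms(3) by auto
  ultimately show ?thesis
    using assms(1,2)
    unfolding ple_def F linear_order_on_def partial_order_on_def preorder_on_def by blast
qed

lemma ple_subset: "ple P r L \<Longrightarrow> L \<subseteq> P \<times> P"
  unfolding ple_def using FieldI1 FieldI2 by fast

text \<open>Without a local realizer, \<^const>\<open>ldim\<close> would be the least element of an empty set.\<close>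

lemma ldim_attained:
  assumes "finite P" "P \<noteq> {}" "antisym r"
  shows "\<exists>\<L>. local_realizer P r \<L> \<and> max_occurrences P \<L> = ldim P r"
proof -
  \<comment> \<open>All partial linear extensions together form a local realizer, finite because
    \<open>P\<close> is.\<close>
  define \<L> where "\<L> = {L. ple P r L}"
  have real: "local_realizer P r \<L>"
    unfolding local_realizer_def
  proof (intro conjI ballI impI)
    fix x y assume xy: "x \<in> P" "y \<in> P" "x \<noteq> y \<and> (x, y) \<in> r"
    then have "(y, x) \<notin> r" using assms(3) by (auto dest: antisymD)
    then show "\<exists>L\<in>\<L>. (x, y) \<in> L"
      using ple_pair[of x P y r] xy by (intro bexI[of _ "{(x, x), (y, y), (x, y)}"]) (auto simp: \<L>_def)
  next
    fix x y assume xy: "x \<in> P" "y \<in> P" "(x, y) \<notin> r \<and> (y, x) \<notin> r"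
    then show "\<exists>L\<in>\<L>. (y, x) \<in> L"
      using ple_pair[of y P x r] by (intro bexI[of _ "{(y, y), (x, x), (y, x)}"]) (auto simp: \<L>_def)
  qed (simp add: \<L>_def)
  obtain u where u: "u \<in> P" using assms by auto
  have "finite \<L>"
    by (rule finite_subset[of _ "Pow (P \<times> P)"]) (use assms ple_subset in \<open>auto simp: \<L>_def\<close>)
  \<comment> \<open>The one-point extension makes the maximum positive, as \<open>ldim\<close>
    demands.\<close>
  moreover have "{(u, u)} \<in> {L \<in> \<L>. u \<in> Field L}"
    using ple_pair[of u P u r] u by (auto simp: \<L>_def Field_def)
  ultimately have "0 < occurrences u \<L>"
    unfolding occurrences_def by (subst card_gt_0_iff) auto
  also have "\<dots> \<le> max_occurrences P \<L>"
    using assms u by (simp add: max_occurrences_def)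
  finally have "\<exists>d. d > 0 \<and> (\<exists>\<L>. local_realizer P r \<L> \<and> max_occurrences P \<L> = d)"
    using real by blast
  from LeastI_ex[OF this] show ?thesis by (simp add: ldim_def)
qed

text \<open>The members index themselves; by reflexivity, \<open>(x, x)\<close> in a member means
  that \<open>x\<close> is in its field.\<close>

lemma local_realizer_ple_family:
  assumes "finite P" "local_realizer P r \<L>"
  shows "ple_family P r \<L> (\<lambda>L. L) (max_occurrences P \<L>)"
proof -
  have ple: "ple P r L" if "L \<in> \<L>" for L using assms that by (auto simp: local_realizer_def)
  have refl: "(x, x) \<in> L \<longleftrightarrow> x \<in> Field L" if "L \<in> \<L>" for x L
    using ple[OF that]
    by (auto simp: ple_def linear_order_on_def partial_order_on_def preorder_on_def refl_on_def
        intro: FieldI1)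
  have fin: "finite \<L>"
    by (rule finite_subset[of _ "Pow (P \<times> P)"]) (use assms(1) ple_subset[OF ple] in auto)
  show ?thesis
  proof
    fix L x y assume L: "L \<in> \<L>"
    show "trans L" "antisym L"
      using ple[OF L]
      by (simp_all add: ple_def linear_order_on_def partial_order_on_def preorder_on_def)
    show "(x, x) \<in> L \<and> (y, y) \<in> L" if "(x, y) \<in> L"
      using that refl[OF L] by (auto intro: FieldI1 FieldI2)
    show "(x, y) \<in> L" if "(x, y) \<in> r" "(x, x) \<in> L" "(y, y) \<in> L"
      using that refl[OF L] ple[OF L] by (auto simp: ple_def)
  next
    fix x y assume "x \<in> P" "y \<in> P" "(x, y) \<notin> r" "(y, x) \<notin> r"
    then show "\<exists>L\<in>\<L>. (y, x) \<in> L" using assms by (auto simp: local_realizer_def)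
  next
    fix x assume "x \<in> P"
    show "finite {L \<in> \<L>. (x, x) \<in> L}" using fin by simp
    have "{L \<in> \<L>. (x, x) \<in> L} = {L \<in> \<L>. x \<in> Field L}" using refl by blast
    then show "card {L \<in> \<L>. (x, x) \<in> L} \<le> max_occurrences P \<L>"
      using assms \<open>x \<in> P\<close> by (simp add: max_occurrences_def occurrences_def)
  qed
qed

lemma ldim_kelly_ge:
  assumes "(Suc d)\<^sup>2 + 1 < n"
  shows "Suc d \<le> ldim (kelly_set n (Suc d)) (kelly_ord n (Suc d))"
proof (rule ccontr)
  let ?P = "kelly_set n (Suc d)" and ?r = "kelly_ord n (Suc d)"
  assume less: "\<not> Suc d \<le> ldim ?P ?r"
  have "?P \<noteq> {}" using b_in_kelly_set[of 1 n d] assms by auto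
  then obtain \<L> where \<L>: "local_realizer ?P ?r \<L>" "max_occurrences ?P \<L> = ldim ?P ?r"
    using ldim_attained[OF finite_kelly_set _ kelly_ord_antisym] by blast
  interpret ple_family ?P ?r \<L> "\<lambda>L. L" "ldim ?P ?r"
    using local_realizer_ple_family[OF finite_kelly_set \<L>(1)] \<L>(2) by simp
  \<comment> \<open>The left side is the total growth of \<open>F\<close> from the empty set;
    \<open>(Suc d)\<^sup>2\<close> is a rough bound for it.\<close>
  have "ldim ?P ?r * d \<le> Suc d * Suc d"
    using less by (intro mult_le_mono) auto
  then have "card {} + ldim ?P ?r * d + 1 < n"
    using assms by (simp add: power2_eq_square)
  then obtain u T where u: "u \<in> ?P" and T: "T \<subseteq> \<L>" "card T = Suc d" "\<forall>t\<in>T. (u, u) \<in> t"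
    using kelly_many_occurrences[OF ple_family_axioms, of "{}"] by auto
  have "card T \<le> card {t \<in> \<L>. (u, u) \<in> t}"
    using T by (intro card_mono finite_occ[OF u]) auto
  with card_occ[OF u] T less show False by simp
qed

theorem theorem10:
  fixes d :: nat
  assumes "d \<ge> 1"
  shows "\<exists>nd::nat. nd \<ge> 2 \<and>
           (\<forall>n\<ge>nd. ldim (kelly_set n d) (kelly_ord n d) \<ge> d) \<and>
           (\<forall>m::nat. m \<ge> 2 \<and> (\<forall>n\<ge>m. ldim (kelly_set n d) (kelly_ord n d) \<ge> d) \<longrightarrow> nd \<le> m)"
proof -
  let ?P = "\<lambda>m::nat. m \<ge> 2 \<and> (\<forall>n\<ge>m. ldim (kelly_set n d) (kelly_ord n d) \<ge> d)"
  obtain d' where "d = Suc d'" using assms by (cases d) auto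
  \<comment> \<open>An explicit threshold shows that some bound exists, so a least one does.\<close>
  then have "?P (d\<^sup>2 + 2)" using ldim_kelly_ge[of d'] by auto
  then have "?P (LEAST m. ?P m)" by (rule LeastI)
  then show ?thesis using Least_le[of ?P] by blast
qed

end
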